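(* Let $C$ be a category with pullbacks and a coverage $\tau$. Assume that $(E,M)$ is a $\tau$-well behaved pair of classes of morphisms of $C$. Then the $\tau$-compact objects are closed under $E$-quotients and $E$-weak extensions. Furthermore, if $C$ is pointed and each product projection $x\times y\to x$ is $(E,M)$-image compatible with $\tau$, then the $\tau$-compact objects are closed under binary products.
   Context: Morphism classes. Let $C$ have pullbacks. A class of morphisms is a system if it contains all isomorphisms and is closed under composition; it is stable if it is closed under pullback along arbitrary morphisms; it is left-cancelable if $gf\in A$ and $g\in A$ imply $f\in A$, and right-cancelable if $gf\in A$ and $f\in A$ imply $g\in A$. A morphism $f$ is an $M$-extremal epimorphism if $f=mg$ with $m\in M$ implies that $m$ is an isomorphism; it is stably so if every pullback of $f$ is an $M$-extremal epimorphism. Pointed means having a zero object. Variance. A variance on a category $I$ is a pair $(\mathrm{Cov},\mathrm{Contr})$ of classes of morphisms, each closed under composition and containing all identities, such that each morphism factors uniquely as $ba$ with $a\in \mathrm{Cov}$, $b\in\mathrm{Contr}$, and also uniquely as $ab$ with $a\in\mathrm{Cov}$, $b\in\mathrm{Contr}$. For $f\colon x\to y$ write $f=f^-f^+$ with $f^+\colon x\to f_t$ in $\mathrm{Cov}$, $f^-\colon f_t\to y$ in $\mathrm{Contr}$, and $f=f_+f_-$ with $f_-\colon x\to f_s$ in $\mathrm{Contr}$, $f_+\colon f_s\to y$ in $\mathrm{Cov}$. A functor $F\colon I\to D$ of variance $(\mathrm{Cov},\mathrm{Contr})$ assigns to each object $i$ an object $F(i)$ and to each morphism $f$ a morphism $F(f)\colon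 F(f_s)\to F(f_t)$, preserving identities, such that for each composable $x\xrightarrow{f}y\xrightarrow{g}z$, $$F(gf)=F((g^+f^-)^+)\circ F(f)\circ F((g_-f_+)_-)=F((g^+f^-)^-)\circ F(g)\circ F((g_-f_+)_+).$$ A natural transformation $\eta\colon F\Rightarrow G$ of such functors is a family $\eta_i\colon F(i)\to G(i)$ with $G(f)\eta_{f_s}=\eta_{f_t}F(f)$ for every morphism $f$ of $I$. Coverages. A diagram type is a tuple $(I,A,\mathrm{Cov},\mathrm{Contr})$ with $I$ a small category with variance $(\mathrm{Cov},\mathrm{Contr})$ and $A$ a set of objects of $I$ (the designated small objects) such that for all $x,y\in A$ there are morphisms $x\to z\leftarrow y$ in $I$ with $z\in A$. A global selection $\tau$ on $C$ assigns to each object $c$ a class $\tau_c$ of tuples $(F\colon I\to C/c,A,\mathrm{Cov},\mathrm{Contr})$, called coverings of $c$, where $(I,A,\mathrm{Cov},\mathrm{Contr})$ is a diagram type and $F$ is a functor of variance $(\mathrm{Cov},\mathrm{Contr})$ into the slice category $C/c$. For an object $i$ of $I$, $F(i)$ is regarded as a morphism $c_i\to c$ of $C$. A global selection is a coverage if for each $f\colon x\to y$ and each covering $(F,A,\mathrm{Cov},\mathrm{Contr})$ of $y$, the tuple $(f^*(F),A,\mathrm{Cov},\mathrm{Contr})$ is a covering of $x$, where $f^*(F)\colon I\to C/x$ is the functor of variance $(\mathrm{Cov},\mathrm{Contr})$ induced by pulling back along $f$. An object $c$ is $\tau$-compact if for every covering $(F,A,\mathrm{Cov},\mathrm{Contr})$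 of $c$ there is $i_0\in A$ such that $F(k)$ is an isomorphism for any composable pair $i_0\to i\xrightarrow{k}j$ in $I$. A functor $F\colon I\to C/c$ is subordinated to $M$ if $F(i)\in M$ for each object $i$ of $I$; $\tau$ is subordinated to $M$ if all its coverings are. Image compatibility. A morphism $f\colon c\to d$ is $(E,M)$-image compatible with $\tau$ if for every covering $(F\colon I\to C/c,A,\mathrm{Cov},\mathrm{Contr})\in\tau_c$ there are a covering $(G\colon I\to C/d,A,\mathrm{Cov},\mathrm{Contr})\in\tau_d$ subordinated to $M$ and a natural transformation $\eta\colon f_*F\Rightarrow G$ whose components lie in $E$ (as morphisms of $C$), where $f_*\colon C/c\to C/d$ is post-composition with $f$. Protomodularity. $E$ satisfies the $M$-protomodularity condition if the following holds: given morphisms $m'\colon a'\to b'$, $e'\colon b'\to c'$, $m\colon a\to b$, $e\colon b\to c$, $\alpha\colon a'\to a$, $\beta\colon b'\to b$, $\gamma\colon c'\to c$ with $\beta m'=m\alpha$ a pullback square, $e\beta=\gamma e'$, $m$ a pullback along $e$ of some morphism $\theta\colon w\to c$, $e,e'\in E$, $\beta\in M$, and $\alpha,\gamma$ isomorphisms, then $\beta$ is an isomorphism. Well-behaved pairs. The pair $(E,M)$ is $\tau$-well behaved if: (i) $M$ is a stable and left-cancelable system and $\tau$ is subordinated to $M$; (ii) $E$ satisfies the $M$-protomodularity condition and each morphism in $E$ is $(E,M)$-image compatible with $\tau$; (iii) at least one of the following holds: all morphisms of $E$ are stably $M$-extremal epimorphisms; or $E$ is a right-cancelable, stable system of $C$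 and $E\cap M$ is the class of isomorphisms. Closure. A class $X$ of objects is closed under $E$-quotients if $a\in X$ and $a\to b\in E$ imply $b\in X$. It is closed under $E$-weak extensions if for every pullback square with $\bar f\colon a\to d$, $\bar\phi\colon a\to b$, $f\colon b\to c$, $\phi\colon d\to c$, where $a,c\in X$ and $f\in E$, one has $b\in X$. *)

theory Defs
  imports "HOL-Library.FuncSet"
begin

section \<open>Categories\<close>

text \<open>Objects and morphisms form sets over arbitrary types, so the types play the role of
  universes. Composition is in the usual order: \<open>g \<cdot> f\<close> is \<open>f\<close> followed by \<open>g\<close>.\<close>

record ('o, 'm) cat =
  Obj :: "'o set"
  Arr :: "'m set"
  Dom :: "'m \<Rightarrow> 'o"
  Cod :: "'m \<Rightarrow> 'o"
  Ident :: "'o \<Rightarrow> 'm"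
  Comp :: "'m \<Rightarrow> 'm \<Rightarrow> 'm"  (infixr "\<cdot>\<index>" 70)

definition hom :: "('o, 'm, 'x) cat_scheme \<Rightarrow> 'o \<Rightarrow> 'o \<Rightarrow> 'm set" where
  "hom C x y = {f \<in> Arr C. Dom C f = x \<and> Cod C f = y}"

locale category =
  fixes C :: "('o, 'm, 'x) cat_scheme" (structure)
  assumes dom_in: "f \<in> Arr C \<Longrightarrow> Dom C f \<in> Obj C"
    and cod_in: "f \<in> Arr C \<Longrightarrow> Cod C f \<in> Obj C"
    and ident_in: "x \<in> Obj C \<Longrightarrow> Ident C x \<in> hom C x x"
    and comp_in: "\<lbrakk>f \<in> hom C x y; g \<in> hom C y z\<rbrakk> \<Longrightarrow> g \<cdot> f \<in> hom C x z"
    and comp_ident_right: "f \<in> hom C x y \<Longrightarrow> f \<cdot> Ident C x = f"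
    and comp_ident_left: "f \<in> hom C x y \<Longrightarrow> Ident C y \<cdot> f = f"
    and comp_assoc: "\<lbrakk>f \<in> hom C w x; g \<in> hom C x y; h \<in> hom C y z\<rbrakk>
      \<Longrightarrow> (h \<cdot> g) \<cdot> f = h \<cdot> (g \<cdot> f)"

definition is_iso :: "('o, 'm, 'x) cat_scheme \<Rightarrow> 'm \<Rightarrow> bool" where
  "is_iso C f \<longleftrightarrow> f \<in> Arr C \<and>
     (\<exists>g \<in> hom C (Cod C f) (Dom C f).
        g \<cdot>\<^bsub>C\<^esub> f = Ident C (Dom C f) \<and> f \<cdot>\<^bsub>C\<^esub> g = Ident C (Cod C f))"

text \<open>\<open>is_pullback C p q f g\<close>: the square \<open>f \<cdot> p = g \<cdot> q\<close> is a pullback; \<open>p\<close> is the pullback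
  of \<open>g\<close> along \<open>f\<close>, and \<open>q\<close> the pullback of \<open>f\<close> along \<open>g\<close>.\<close>

definition is_pullback ::
  "('o, 'm, 'x) cat_scheme \<Rightarrow> 'm \<Rightarrow> 'm \<Rightarrow> 'm \<Rightarrow> 'm \<Rightarrow> bool" where
  "is_pullback C p q f g \<longleftrightarrow>
     p \<in> Arr C \<and> q \<in> Arr C \<and> f \<in> Arr C \<and> g \<in> Arr C \<and>
     Dom C p = Dom C q \<and> Cod C p = Dom C f \<and> Cod C q = Dom C g \<and> Cod C f = Cod C g \<and>
     f \<cdot>\<^bsub>C\<^esub> p = g \<cdot>\<^bsub>C\<^esub> q \<and>
     (\<forall>w u v. u \<in> hom C w (Dom C f) \<and> v \<in> hom C w (Dom C g) \<and> f \<cdot>\<^bsub>C\<^esub> u = g \<cdot>\<^bsub>C\<^esub> v \<longrightarrow>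
        (\<exists>!h. h \<in> hom C w (Dom C p) \<and> p \<cdot>\<^bsub>C\<^esub> h = u \<and> q \<cdot>\<^bsub>C\<^esub> h = v))"

text \<open>A category with pullbacks carries a choice of a pullback for every cospan. The choice is
  used only to define the pullback functors between slices.\<close>

definition pullback_choice ::
  "('o, 'm, 'x) cat_scheme \<Rightarrow> ('m \<Rightarrow> 'm \<Rightarrow> 'm \<times> 'm) \<Rightarrow> bool" where
  "pullback_choice C pb \<longleftrightarrow>
     (\<forall>f \<in> Arr C. \<forall>g \<in> Arr C. Cod C f = Cod C g \<longrightarrow>
        is_pullback C (fst (pb f g)) (snd (pb f g)) f g)"

definition is_product :: "('o, 'm, 'x) cat_scheme \<Rightarrow> 'm \<Rightarrow> 'm \<Rightarrow> bool" where
  "is_product C p q \<longleftrightarrow>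
     p \<in> Arr C \<and> q \<in> Arr C \<and> Dom C p = Dom C q \<and>
     (\<forall>w u v. u \<in> hom C w (Cod C p) \<and> v \<in> hom C w (Cod C q) \<longrightarrow>
        (\<exists>!h. h \<in> hom C w (Dom C p) \<and> p \<cdot>\<^bsub>C\<^esub> h = u \<and> q \<cdot>\<^bsub>C\<^esub> h = v))"

definition pointed :: "('o, 'm, 'x) cat_scheme \<Rightarrow> bool" where
  "pointed C \<longleftrightarrow>
     (\<exists>z \<in> Obj C. \<forall>x \<in> Obj C. (\<exists>!f. f \<in> hom C z x) \<and> (\<exists>!f. f \<in> hom C x z))"

section \<open>Classes of morphisms\<close>

definition system :: "('o, 'm, 'x) cat_scheme \<Rightarrow> 'm set \<Rightarrow> bool" where
  "system C A \<longleftrightarrow>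
     (\<forall>f. is_iso C f \<longrightarrow> f \<in> A) \<and>
     (\<forall>f \<in> A. \<forall>g \<in> A. Cod C f = Dom C g \<longrightarrow> g \<cdot>\<^bsub>C\<^esub> f \<in> A)"

definition stable :: "('o, 'm, 'x) cat_scheme \<Rightarrow> 'm set \<Rightarrow> bool" where
  "stable C A \<longleftrightarrow> (\<forall>p q f g. is_pullback C p q f g \<and> g \<in> A \<longrightarrow> p \<in> A)"

definition left_cancelable :: "('o, 'm, 'x) cat_scheme \<Rightarrow> 'm set \<Rightarrow> bool" where
  "left_cancelable C A \<longleftrightarrow>
     (\<forall>f \<in> Arr C. \<forall>g \<in> Arr C. Cod C f = Dom C g \<and> g \<cdot>\<^bsub>C\<^esub> f \<in> A \<and> g \<in> A \<longrightarrow> f \<in> A)"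

definition right_cancelable :: "('o, 'm, 'x) cat_scheme \<Rightarrow> 'm set \<Rightarrow> bool" where
  "right_cancelable C A \<longleftrightarrow>
     (\<forall>f \<in> Arr C. \<forall>g \<in> Arr C. Cod C f = Dom C g \<and> g \<cdot>\<^bsub>C\<^esub> f \<in> A \<and> f \<in> A \<longrightarrow> g \<in> A)"

definition extremal_epi :: "('o, 'm, 'x) cat_scheme \<Rightarrow> 'm set \<Rightarrow> 'm \<Rightarrow> bool" where
  "extremal_epi C M f \<longleftrightarrow> f \<in> Arr C \<and>
     (\<forall>m \<in> M. \<forall>g \<in> Arr C. Cod C g = Dom C m \<and> f = m \<cdot>\<^bsub>C\<^esub> g \<longrightarrow> is_iso C m)"

definition stably_extremal_epi :: "('o, 'm, 'x) cat_scheme \<Rightarrow> 'm set \<Rightarrow> 'm \<Rightarrow> bool" where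
  "stably_extremal_epi C M f \<longleftrightarrow> f \<in> Arr C \<and>
     (\<forall>p q h. is_pullback C p q h f \<longrightarrow> extremal_epi C M p)"

definition protomodular :: "('o, 'm, 'x) cat_scheme \<Rightarrow> 'm set \<Rightarrow> 'm set \<Rightarrow> bool" where
  "protomodular C E M \<longleftrightarrow>
     (\<forall>a' b' c' a b c m' e' m e \<alpha> \<beta> \<gamma>.
        m' \<in> hom C a' b' \<and> e' \<in> hom C b' c' \<and> m \<in> hom C a b \<and> e \<in> hom C b c \<and>
        \<alpha> \<in> hom C a' a \<and> \<beta> \<in> hom C b' b \<and> \<gamma> \<in> hom C c' c \<and>
        is_pullback C m' \<alpha> \<beta> m \<and> e \<cdot>\<^bsub>C\<^esub> \<beta> = \<gamma> \<cdot>\<^bsub>C\<^esub> e' \<and>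
        (\<exists>w. \<exists>\<theta> \<in> hom C w c. \<exists>t. is_pullback C m t e \<theta>) \<and>
        e \<in> E \<and> e' \<in> E \<and> \<beta> \<in> M \<and> is_iso C \<alpha> \<and> is_iso C \<gamma>
        \<longrightarrow> is_iso C \<beta>)"

section \<open>Variances and diagram types\<close>

record ('i, 'j) variance_cat = "('i, 'j) cat" +
  Cov :: "'j set"
  Contr :: "'j set"

definition factorizations ::
  "('i, 'j, 'x) cat_scheme \<Rightarrow> 'j set \<Rightarrow> 'j set \<Rightarrow> 'j \<Rightarrow> ('j \<times> 'j) set" where
  "factorizations I A B f = {(a, b). a \<in> A \<and> b \<in> B \<and> Cod I a = Dom I b \<and> b \<cdot>\<^bsub>I\<^esub> a = f}"

definition wide_subcategory :: "('i, 'j, 'x) cat_scheme \<Rightarrow> 'j set \<Rightarrow> bool" where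
  "wide_subcategory I A \<longleftrightarrow> A \<subseteq> Arr I \<and> (\<forall>i \<in> Obj I. Ident I i \<in> A) \<and>
     (\<forall>f \<in> A. \<forall>g \<in> A. Cod I f = Dom I g \<longrightarrow> g \<cdot>\<^bsub>I\<^esub> f \<in> A)"

definition variance :: "('i, 'j, 'x) variance_cat_scheme \<Rightarrow> bool" where
  "variance I \<longleftrightarrow> wide_subcategory I (Cov I) \<and> wide_subcategory I (Contr I) \<and>
     (\<forall>f \<in> Arr I. (\<exists>!p. p \<in> factorizations I (Cov I) (Contr I) f) \<and>
                  (\<exists>!p. p \<in> factorizations I (Contr I) (Cov I) f))"

text \<open>\<open>f = f\<^sup>- f\<^sup>+\<close> with \<open>f\<^sup>+ = up_cov I f\<close> and \<open>f\<^sup>- = up_contr I f\<close>, and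
  \<open>f = f\<^sub>+ f\<^sub>-\<close> with \<open>f\<^sub>- = lo_contr I f\<close> and \<open>f\<^sub>+ = lo_cov I f\<close>; the middle objects are
  \<open>f\<^sub>t = tgt I f\<close> and \<open>f\<^sub>s = src I f\<close>.\<close>

definition up_cov :: "('i, 'j, 'x) variance_cat_scheme \<Rightarrow> 'j \<Rightarrow> 'j" where
  "up_cov I f = fst (THE p. p \<in> factorizations I (Cov I) (Contr I) f)"

definition up_contr :: "('i, 'j, 'x) variance_cat_scheme \<Rightarrow> 'j \<Rightarrow> 'j" where
  "up_contr I f = snd (THE p. p \<in> factorizations I (Cov I) (Contr I) f)"

definition lo_contr :: "('i, 'j, 'x) variance_cat_scheme \<Rightarrow> 'j \<Rightarrow> 'j" where
  "lo_contr I f = fst (THE p. p \<in> factorizations I (Contr I) (Cov I) f)"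

definition lo_cov :: "('i, 'j, 'x) variance_cat_scheme \<Rightarrow> 'j \<Rightarrow> 'j" where
  "lo_cov I f = snd (THE p. p \<in> factorizations I (Contr I) (Cov I) f)"

definition tgt :: "('i, 'j, 'x) variance_cat_scheme \<Rightarrow> 'j \<Rightarrow> 'i" where
  "tgt I f = Cod I (up_cov I f)"

definition src :: "('i, 'j, 'x) variance_cat_scheme \<Rightarrow> 'j \<Rightarrow> 'i" where
  "src I f = Cod I (lo_contr I f)"

record ('i, 'j, 'o, 'm) funct =
  fobj :: "'i \<Rightarrow> 'o"
  farr :: "'j \<Rightarrow> 'm"

text \<open>The maps of a functor are required to be \<open>undefined\<close> outside the source category, so that
  equality of functors is equality of records.\<close>

definition variance_functor ::
  "('i, 'j, 'x) variance_cat_scheme \<Rightarrow> ('o, 'm, 'y) cat_scheme \<Rightarrow> ('i, 'j, 'o, 'm) funct \<Rightarrow> bool"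
  where
  "variance_functor I D F \<longleftrightarrow>
     fobj F \<in> Obj I \<rightarrow>\<^sub>E Obj D \<and> farr F \<in> extensional (Arr I) \<and>
     (\<forall>f \<in> Arr I. farr F f \<in> hom D (fobj F (src I f)) (fobj F (tgt I f))) \<and>
     (\<forall>i \<in> Obj I. farr F (Ident I i) = Ident D (fobj F i)) \<and>
     (\<forall>f \<in> Arr I. \<forall>g \<in> Arr I. Cod I f = Dom I g \<longrightarrow>
        (let u = up_cov I g \<cdot>\<^bsub>I\<^esub> up_contr I f;
             l = lo_contr I g \<cdot>\<^bsub>I\<^esub> lo_cov I f
         in farr F (g \<cdot>\<^bsub>I\<^esub> f)
              = farr F (up_cov I u) \<cdot>\<^bsub>D\<^esub> farr F f \<cdot>\<^bsub>D\<^esub> farr F (lo_contr I l) \<and>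
            farr F (g \<cdot>\<^bsub>I\<^esub> f)
              = farr F (up_contr I u) \<cdot>\<^bsub>D\<^esub> farr F g \<cdot>\<^bsub>D\<^esub> farr F (lo_cov I l)))"

definition natural_transformation ::
  "('i, 'j, 'x) variance_cat_scheme \<Rightarrow> ('o, 'm, 'y) cat_scheme \<Rightarrow>
   ('i, 'j, 'o, 'm) funct \<Rightarrow> ('i, 'j, 'o, 'm) funct \<Rightarrow> ('i \<Rightarrow> 'm) \<Rightarrow> bool" where
  "natural_transformation I D F G \<eta> \<longleftrightarrow>
     (\<forall>i \<in> Obj I. \<eta> i \<in> hom D (fobj F i) (fobj G i)) \<and>
     (\<forall>f \<in> Arr I. farr G f \<cdot>\<^bsub>D\<^esub> \<eta> (src I f) = \<eta> (tgt I f) \<cdot>\<^bsub>D\<^esub> farr F f)"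

text \<open>The composite of a functor \<open>F\<close> of some variance on \<open>I\<close> with an ordinary functor \<open>H\<close>.\<close>

definition funct_comp ::
  "('i, 'j, 'x) cat_scheme \<Rightarrow> ('o, 'm, 'p, 'n) funct \<Rightarrow> ('i, 'j, 'o, 'm) funct \<Rightarrow>
   ('i, 'j, 'p, 'n) funct" where
  "funct_comp I H F =
     \<lparr>fobj = (\<lambda>i \<in> Obj I. fobj H (fobj F i)), farr = (\<lambda>f \<in> Arr I. farr H (farr F f))\<rparr>"

record ('i, 'j) diagram = "('i, 'j) variance_cat" +
  Designated :: "'i set"

definition diagram_type :: "('i, 'j) diagram \<Rightarrow> bool" where
  "diagram_type I \<longleftrightarrow> category I \<and> variance I \<and> Designated I \<subseteq> Obj I \<and>
     (\<forall>x \<in> Designated I. \<forall>y \<in> Designated I.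
        \<exists>z \<in> Designated I. hom I x z \<noteq> {} \<and> hom I y z \<noteq> {})"

section \<open>Slices\<close>

text \<open>The triple \<open>(g, h, g')\<close> is the morphism \<open>h\<close> of \<open>C\<close>, regarded as a morphism from
  \<open>g\<close> to \<open>g'\<close> in the slice.\<close>

type_synonym 'm slice_arr = "'m \<times> 'm \<times> 'm"

definition slice :: "('o, 'm, 'x) cat_scheme \<Rightarrow> 'o \<Rightarrow> ('m, 'm slice_arr) cat" where
  "slice C c =
     \<lparr>Obj = {g \<in> Arr C. Cod C g = c},
      Arr = {(g, h, g'). g \<in> Arr C \<and> g' \<in> Arr C \<and> Cod C g = c \<and> Cod C g' = c \<and>
                         h \<in> hom C (Dom C g) (Dom C g') \<and> g' \<cdot>\<^bsub>C\<^esub> h = g},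
      Dom = (\<lambda>(g, h, g'). g),
      Cod = (\<lambda>(g, h, g'). g'),
      Ident = (\<lambda>g. (g, Ident C (Dom C g), g)),
      Comp = (\<lambda>(g', k, g'') (g, h, _). (g, k \<cdot>\<^bsub>C\<^esub> h, g''))\<rparr>"

definition underlying :: "'m slice_arr \<Rightarrow> 'm" where
  "underlying = (\<lambda>(g, h, g'). h)"

type_synonym ('i, 'j, 'm) slice_funct = "('i, 'j, 'm, 'm slice_arr) funct"

definition post_functor ::
  "('o, 'm, 'x) cat_scheme \<Rightarrow> 'm \<Rightarrow> ('m, 'm slice_arr, 'm) slice_funct" where
  "post_functor C f =
     \<lparr>fobj = (\<lambda>g. f \<cdot>\<^bsub>C\<^esub> g), farr = (\<lambda>(g, h, g'). (f \<cdot>\<^bsub>C\<^esub> g, h, f \<cdot>\<^bsub>C\<^esub> g'))\<rparr>"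

text \<open>On morphisms, \<open>f\<^sup>*\<close> is given by the universal property of the chosen pullbacks.\<close>

definition pull_functor ::
  "('o, 'm, 'x) cat_scheme \<Rightarrow> ('m \<Rightarrow> 'm \<Rightarrow> 'm \<times> 'm) \<Rightarrow> 'm \<Rightarrow>
   ('m, 'm slice_arr, 'm) slice_funct" where
  "pull_functor C pb f =
     \<lparr>fobj = (\<lambda>g. fst (pb f g)),
      farr = (\<lambda>(g, h, g').
        (fst (pb f g),
         (THE k. k \<in> hom C (Dom C (fst (pb f g))) (Dom C (fst (pb f g'))) \<and>
                 fst (pb f g') \<cdot>\<^bsub>C\<^esub> k = fst (pb f g) \<and>
                 snd (pb f g') \<cdot>\<^bsub>C\<^esub> k = h \<cdot>\<^bsub>C\<^esub> snd (pb f g)),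
         fst (pb f g')))\<rparr>"

section \<open>Coverages\<close>

text \<open>A covering \<open>(I, F)\<close>: the diagram type \<open>I\<close> bundles the indexing category, its variance and
  its designated small objects.\<close>

type_synonym ('i, 'j, 'm) covering = "('i, 'j) diagram \<times> ('i, 'j, 'm) slice_funct"

definition global_selection ::
  "('o, 'm, 'x) cat_scheme \<Rightarrow> ('o \<Rightarrow> ('i, 'j, 'm) covering set) \<Rightarrow> bool" where
  "global_selection C \<tau> \<longleftrightarrow>
     (\<forall>c \<in> Obj C. \<forall>(I, F) \<in> \<tau> c. diagram_type I \<and> variance_functor I (slice C c) F)"

definition coverage ::
  "('o, 'm, 'x) cat_scheme \<Rightarrow> ('m \<Rightarrow> 'm \<Rightarrow> 'm \<times> 'm) \<Rightarrow>
   ('o \<Rightarrow> ('i, 'j, 'm) covering set) \<Rightarrow> bool" where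
  "coverage C pb \<tau> \<longleftrightarrow> global_selection C \<tau> \<and>
     (\<forall>f \<in> Arr C. \<forall>(I, F) \<in> \<tau> (Cod C f).
        (I, funct_comp I (pull_functor C pb f) F) \<in> \<tau> (Dom C f))"

definition compact_objects ::
  "('o, 'm, 'x) cat_scheme \<Rightarrow> ('o \<Rightarrow> ('i, 'j, 'm) covering set) \<Rightarrow> 'o set" where
  "compact_objects C \<tau> = {c \<in> Obj C. \<forall>(I, F) \<in> \<tau> c. \<exists>i\<^sub>0 \<in> Designated I.
     \<forall>i j. \<forall>u \<in> hom I i\<^sub>0 i. \<forall>k \<in> hom I i j. is_iso (slice C c) (farr F k)}"

definition functor_subordinated ::
  "('i, 'j, 'x) cat_scheme \<Rightarrow> 'm set \<Rightarrow> ('i, 'j, 'm) slice_funct \<Rightarrow> bool" where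
  "functor_subordinated I M F \<longleftrightarrow> (\<forall>i \<in> Obj I. fobj F i \<in> M)"

definition subordinated ::
  "('o, 'm, 'x) cat_scheme \<Rightarrow> ('o \<Rightarrow> ('i, 'j, 'm) covering set) \<Rightarrow> 'm set \<Rightarrow> bool" where
  "subordinated C \<tau> M \<longleftrightarrow> (\<forall>c \<in> Obj C. \<forall>(I, F) \<in> \<tau> c. functor_subordinated I M F)"

definition image_compatible ::
  "('o, 'm, 'x) cat_scheme \<Rightarrow> ('o \<Rightarrow> ('i, 'j, 'm) covering set) \<Rightarrow> 'm set \<Rightarrow> 'm set \<Rightarrow> 'm \<Rightarrow> bool"
  where
  "image_compatible C \<tau> E M f \<longleftrightarrow>
     (\<forall>(I, F) \<in> \<tau> (Dom C f). \<exists>G \<eta>.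
        (I, G) \<in> \<tau> (Cod C f) \<and> functor_subordinated I M G \<and>
        natural_transformation I (slice C (Cod C f)) (funct_comp I (post_functor C f) F) G \<eta> \<and>
        (\<forall>i \<in> Obj I. underlying (\<eta> i) \<in> E))"

definition well_behaved ::
  "('o, 'm, 'x) cat_scheme \<Rightarrow> ('o \<Rightarrow> ('i, 'j, 'm) covering set) \<Rightarrow> 'm set \<Rightarrow> 'm set \<Rightarrow> bool" where
  "well_behaved C \<tau> E M \<longleftrightarrow>
     (system C M \<and> stable C M \<and> left_cancelable C M \<and> subordinated C \<tau> M) \<and>
     (protomodular C E M \<and> (\<forall>f \<in> E. image_compatible C \<tau> E M f)) \<and>
     ((\<forall>f \<in> E. stably_extremal_epi C M f) \<or>
      (right_cancelable C E \<and> system C E \<and> stable C E \<and> E \<inter> M = {f. is_iso C f}))"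

section \<open>Closure properties of classes of objects\<close>

definition closed_under_quotients :: "('o, 'm, 'x) cat_scheme \<Rightarrow> 'm set \<Rightarrow> 'o set \<Rightarrow> bool" where
  "closed_under_quotients C E X \<longleftrightarrow> (\<forall>f \<in> E. Dom C f \<in> X \<longrightarrow> Cod C f \<in> X)"

definition closed_under_weak_extensions ::
  "('o, 'm, 'x) cat_scheme \<Rightarrow> 'm set \<Rightarrow> 'o set \<Rightarrow> bool" where
  "closed_under_weak_extensions C E X \<longleftrightarrow>
     (\<forall>a b c d f' \<phi>' f \<phi>.
        f' \<in> hom C a d \<and> \<phi>' \<in> hom C a b \<and> f \<in> hom C b c \<and> \<phi> \<in> hom C d c \<and>
        is_pullback C \<phi>' f' f \<phi> \<and> a \<in> X \<and> c \<in> X \<and> f \<in> E \<longrightarrow> b \<in> X)"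

definition closed_under_binary_products :: "('o, 'm, 'x) cat_scheme \<Rightarrow> 'o set \<Rightarrow> bool" where
  "closed_under_binary_products C X \<longleftrightarrow>
     (\<forall>p q. is_product C p q \<and> Cod C p \<in> X \<and> Cod C q \<in> X \<longrightarrow> Dom C p \<in> X)"

end

theory Submission
  imports Defs
begin

text \<open>Let \<open>k\<close> be a morphism of the index category of a covering. If \<open>f \<in> E\<close> and the pullback
  of \<open>G(k)\<close> along \<open>f\<close> is invertible, then \<open>G(k)\<close>, which lies in \<open>M\<close>, is invertible too: a
  pullback of \<open>f\<close> factors through it, and \<open>G(k)\<close> following a pullback of \<open>f\<close> is itself, up to an
  isomorphism, a pullback of \<open>f\<close>. This gives quotients. For weak extensions, the covering \<open>F\<close> of
  \<open>b\<close> is pulled back to \<open>a\<close> and mapped to a covering \<open>G\<close> of \<open>c\<close>. Far enough out in the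
  designated objects both the pulled back \<open>F(k)\<close> and \<open>G(k)\<close> are invertible, and then so is \<open>F(k)\<close>
  by protomodularity, whose pullback hypotheses follow from pasting. This uses only that \<open>f\<close> is
  image compatible; a product projection \<open>x \<times> y \<rightarrow> x\<close> is the case of the pullback
  along \<open>0 \<rightarrow> x\<close>, with \<open>a = y\<close>.\<close>

section \<open>Pullback squares: universal property, pasting and cancellation\<close>

context category
begin

text \<open>Splits the universal property into existence of a lift and joint monicity of the two
  legs, which are then checked separately.\<close>

lemma is_pullbackI:
  assumes "p \<in> hom C a b" "q \<in> hom C a d" "f \<in> hom C b c" "g \<in> hom C d c" "f \<cdot> p = g \<cdot> q"
    and "\<And>w u v. \<lbrakk>u \<in> hom C w b; v \<in> hom C w d; f \<cdot> u = g \<cdot> v\<rbrakk>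
      \<Longrightarrow> \<exists>h \<in> hom C w a. p \<cdot> h = u \<and> q \<cdot> h = v"
    and "\<And>w h h'. \<lbrakk>h \<in> hom C w a; h' \<in> hom C w a; p \<cdot> h = p \<cdot> h'; q \<cdot> h = q \<cdot> h'\<rbrakk> \<Longrightarrow> h = h'"
  shows "is_pullback C p q f g"
proof -
  have D: "Dom C p = a" "Dom C q = a" "Dom C f = b" "Dom C g = d"
    "Cod C p = b" "Cod C q = d" "Cod C f = c" "Cod C g = c"
    "p \<in> Arr C" "q \<in> Arr C" "f \<in> Arr C" "g \<in> Arr C"
    using assms(1-4) by (auto simp: hom_def)
  have "\<exists>!h. h \<in> hom C w a \<and> p \<cdot> h = u \<and> q \<cdot> h = v"
    if "u \<in> hom C w b" "v \<in> hom C w d" "f \<cdot> u = g \<cdot> v" for w u v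
  proof (rule ex_ex1I)
    show "\<exists>h. h \<in> hom C w a \<and> p \<cdot> h = u \<and> q \<cdot> h = v"
      using assms(6)[OF that] by blast
  qed (use assms(7) in auto)
  then show ?thesis
    unfolding is_pullback_def D using D assms(5) by simp
qed

lemma is_pullbackE:
  assumes "is_pullback C p q f g"
  obtains a b c d where "p \<in> hom C a b" "q \<in> hom C a d" "f \<in> hom C b c" "g \<in> hom C d c"
proof
  show "p \<in> hom C (Dom C p) (Dom C f)" "q \<in> hom C (Dom C p) (Dom C g)"
    "f \<in> hom C (Dom C f) (Cod C f)" "g \<in> hom C (Dom C g) (Cod C f)"
    using assms by (auto simp: is_pullback_def hom_def)
qed

lemma pullback_leg:
  assumes "is_pullback C p q f g" "p \<in> hom C a b"
  obtains c d where "q \<in> hom C a d" "f \<in> hom C b c" "g \<in> hom C d c"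
proof
  show "q \<in> hom C a (Dom C g)" "f \<in> hom C b (Cod C f)" "g \<in> hom C (Dom C g) (Cod C f)"
    using assms by (auto simp: is_pullback_def hom_def)
qed

lemma pullback_of_cospan:
  assumes "is_pullback C p q f g" "f \<in> hom C b c" "g \<in> hom C d c"
  obtains a where "p \<in> hom C a b" "q \<in> hom C a d" "Dom C p = a"
proof
  show "p \<in> hom C (Dom C p) b" "q \<in> hom C (Dom C p) d"
    using assms by (auto simp: is_pullback_def hom_def)
qed (rule refl)

lemma pullback_commutes: "is_pullback C p q f g \<Longrightarrow> f \<cdot> p = g \<cdot> q"
  unfolding is_pullback_def by blast

lemma pullback_lift:
  assumes "is_pullback C p q f g" "p \<in> hom C a b" "f \<in> hom C b c" "g \<in> hom C d c"
    and "u \<in> hom C w b" "v \<in> hom C w d" "f \<cdot> u = g \<cdot> v"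
  shows "\<exists>h \<in> hom C w a. p \<cdot> h = u \<and> q \<cdot> h = v"
proof -
  have "Dom C p = a" "Dom C f = b" "Dom C g = d" using assms(2-4) by (auto simp: hom_def)
  with assms(1,5-7) show ?thesis unfolding is_pullback_def by blast
qed

text \<open>Both \<open>h\<close> and \<open>h'\<close> are lifts of the cone that \<open>h\<close>
  itself induces, so uniqueness of lifts identifies them.\<close>

lemma pullback_joint_mono:
  assumes pb: "is_pullback C p q f g" and p: "p \<in> hom C a b"
    and h: "h \<in> hom C w a" "h' \<in> hom C w a" "p \<cdot> h = p \<cdot> h'" "q \<cdot> h = q \<cdot> h'"
  shows "h = h'"
proof -
  obtain b' c d where q: "p \<in> hom C a b'" "q \<in> hom C a d" "f \<in> hom C b' c" "g \<in> hom C d c"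
    using pullback_leg[OF pb p] p by metis
  have D: "Dom C p = a" "Dom C f = b'" "Dom C g = d" using q by (auto simp: hom_def)
  have "f \<cdot> (p \<cdot> h) = g \<cdot> (q \<cdot> h)"
    using comp_assoc[OF h(1) q(1,3)] comp_assoc[OF h(1) q(2,4)] pullback_commutes[OF pb] by simp
  moreover have "\<forall>w u v. u \<in> hom C w b' \<and> v \<in> hom C w d \<and> f \<cdot> u = g \<cdot> v \<longrightarrow>
      (\<exists>!l. l \<in> hom C w a \<and> p \<cdot> l = u \<and> q \<cdot> l = v)"
    using pb unfolding is_pullback_def D by (elim conjE) assumption
  ultimately have "\<exists>!l. l \<in> hom C w a \<and> p \<cdot> l = p \<cdot> h \<and> q \<cdot> l = q \<cdot> h"
    using comp_in[OF h(1) q(1)] comp_in[OF h(1) q(2)] by simp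
  then show ?thesis by (rule ex1E) (metis h)
qed

lemma pullback_sym:
  assumes "is_pullback C p q f g"
  shows "is_pullback C q p g f"
proof -
  obtain a b c d where h: "p \<in> hom C a b" "q \<in> hom C a d" "f \<in> hom C b c" "g \<in> hom C d c"
    using is_pullbackE[OF assms] .
  show ?thesis
  proof (rule is_pullbackI[OF h(2,1,4,3)])
    show "\<exists>k \<in> hom C w a. q \<cdot> k = u \<and> p \<cdot> k = v"
      if "u \<in> hom C w d" "v \<in> hom C w b" "g \<cdot> u = f \<cdot> v" for w u v
      using pullback_lift[OF assms h(1,3,4) that(2,1)] that(3) by auto
  qed (use pullback_commutes[OF assms] pullback_joint_mono[OF assms h(1)] in auto)
qed

text \<open>A cone \<open>u\<close>, \<open>v\<close> over the outer cospan is lifted twice: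
  \<open>t \<cdot> u\<close> and \<open>v\<close> lift through the square over \<open>g\<close> and
  \<open>\<phi>\<close>, and the resulting map together with \<open>u\<close> lifts through the
  square over \<open>t\<close> and \<open>f\<close>.\<close>

lemma pullback_paste:
  assumes P: "is_pullback C p q t f" and Q: "is_pullback C f r g \<phi>"
  shows "is_pullback C p (r \<cdot> q) (g \<cdot> t) \<phi>"
proof -
  obtain a b c d where h: "p \<in> hom C a b" "q \<in> hom C a d" "t \<in> hom C b c" "f \<in> hom C d c"
    using is_pullbackE[OF P] .
  obtain x y where h': "r \<in> hom C d x" "g \<in> hom C c y" "\<phi> \<in> hom C x y"
    using pullback_leg[OF Q h(4)] .
  note H = h h' comp_in[OF h(2) h'(1)] comp_in[OF h(3) h'(2)]
  show ?thesis
  proof (rule is_pullbackI[OF H(1,8,9,7)])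
    show "(g \<cdot> t) \<cdot> p = \<phi> \<cdot> (r \<cdot> q)"
      using comp_assoc[OF H(1,3,6)] comp_assoc[OF H(2,4,6)] comp_assoc[OF H(2,5,7)]
        pullback_commutes[OF P] pullback_commutes[OF Q] by simp
  next
    fix w u v
    assume uv: "u \<in> hom C w b" "v \<in> hom C w x" "(g \<cdot> t) \<cdot> u = \<phi> \<cdot> v"
    then have "g \<cdot> (t \<cdot> u) = \<phi> \<cdot> v" using comp_assoc[OF uv(1) H(3,6)] by simp
    then obtain l where l: "l \<in> hom C w d" "f \<cdot> l = t \<cdot> u" "r \<cdot> l = v"
      using pullback_lift[OF Q H(4,6,7) comp_in[OF uv(1) H(3)] uv(2)] by blast
    then obtain n where n: "n \<in> hom C w a" "p \<cdot> n = u" "q \<cdot> n = l"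
      using pullback_lift[OF P H(1,3,4) uv(1) l(1)] by auto
    then have "(r \<cdot> q) \<cdot> n = v" using l(3) comp_assoc[OF n(1) H(2,5)] by simp
    with n show "\<exists>n \<in> hom C w a. p \<cdot> n = u \<and> (r \<cdot> q) \<cdot> n = v" by blast
  next
    fix w n n'
    assume n: "n \<in> hom C w a" "n' \<in> hom C w a" "p \<cdot> n = p \<cdot> n'" "(r \<cdot> q) \<cdot> n = (r \<cdot> q) \<cdot> n'"
    have "f \<cdot> (q \<cdot> n) = t \<cdot> (p \<cdot> n)" "f \<cdot> (q \<cdot> n') = t \<cdot> (p \<cdot> n')"
      using comp_assoc[OF n(1) H(1,3)] comp_assoc[OF n(1) H(2,4)] comp_assoc[OF n(2) H(1,3)]
        comp_assoc[OF n(2) H(2,4)] pullback_commutes[OF P] by simp_all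
    moreover have "r \<cdot> (q \<cdot> n) = r \<cdot> (q \<cdot> n')"
      using comp_assoc[OF n(1) H(2,5)] comp_assoc[OF n(2) H(2,5)] n(4) by simp
    ultimately have "q \<cdot> n = q \<cdot> n'"
      using pullback_joint_mono[OF Q H(4) comp_in[OF n(1) H(2)] comp_in[OF n(2) H(2)]] n(3) by auto
    then show "n = n'" using pullback_joint_mono[OF P H(1) n(1,2,3)] by blast
  qed
qed

text \<open>A converse of pasting. A cone \<open>u\<close>, \<open>v\<close> over \<open>e\<close>
  and \<open>\<theta>\<close> becomes a cone over the outer cospan when \<open>v\<close> is replaced
  by \<open>r \<cdot> v\<close>. The lift \<open>n\<close> of that cone satisfies
  \<open>T \<cdot> n = v\<close> because \<open>\<theta>\<close> and \<open>r\<close> are jointly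
  monic.\<close>

lemma pullback_cancel:
  assumes Q: "is_pullback C \<theta> r g \<phi>" and P: "is_pullback C p (r \<cdot> T) (g \<cdot> e) \<phi>"
    and p: "p \<in> hom C a b" and e: "e \<in> hom C b c" and T: "T \<in> hom C a d"
    and \<theta>: "\<theta> \<in> hom C d c" and comm: "e \<cdot> p = \<theta> \<cdot> T"
  shows "is_pullback C p T e \<theta>"
proof -
  obtain x y where h: "r \<in> hom C d x" "g \<in> hom C c y" "\<phi> \<in> hom C x y"
    using pullback_leg[OF Q \<theta>] .
  show ?thesis
  proof (rule is_pullbackI[OF p T e \<theta> comm])
    fix w u v
    assume uv: "u \<in> hom C w b" "v \<in> hom C w d" "e \<cdot> u = \<theta> \<cdot> v"
    have rv: "r \<cdot> v \<in> hom C w x" using comp_in[OF uv(2) h(1)] .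
    have "(g \<cdot> e) \<cdot> u = g \<cdot> (\<theta> \<cdot> v)" 
      using comp_assoc[OF uv(1) e h(2)] uv(3) by simp
    also have "\<dots> = \<phi> \<cdot> (r \<cdot> v)"
      using comp_assoc[OF uv(2) \<theta> h(2)] comp_assoc[OF uv(2) h(1,3)] pullback_commutes[OF Q] by simp
    finally obtain n where n: "n \<in> hom C w a" "p \<cdot> n = u" "(r \<cdot> T) \<cdot> n = r \<cdot> v"
      using pullback_lift[OF P p comp_in[OF e h(2)] h(3) uv(1) rv] by blast
    have "r \<cdot> (T \<cdot> n) = r \<cdot> v" using comp_assoc[OF n(1) T h(1)] n(3) by simp
    moreover have "\<theta> \<cdot> (T \<cdot> n) = \<theta> \<cdot> v"
      using comp_assoc[OF n(1) T \<theta>] comp_assoc[OF n(1) p e] n(2) uv(3) comm by simp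
    ultimately have "T \<cdot> n = v"
      using pullback_joint_mono[OF Q \<theta> comp_in[OF n(1) T] uv(2)] by blast
    with n show "\<exists>n \<in> hom C w a. p \<cdot> n = u \<and> T \<cdot> n = v" by blast
  next
    fix w n n'
    assume n: "n \<in> hom C w a" "n' \<in> hom C w a" "p \<cdot> n = p \<cdot> n'" "T \<cdot> n = T \<cdot> n'"
    have "(r \<cdot> T) \<cdot> n = (r \<cdot> T) \<cdot> n'"
      using comp_assoc[OF n(1) T h(1)] comp_assoc[OF n(2) T h(1)] n(4) by simp
    then show "n = n'" using pullback_joint_mono[OF P p n(1,2,3)] by blast
  qed
qed

section \<open>Isomorphisms in slices, and product projections of a pointed category\<close>

lemma in_hom_slice_iff:
  "x \<in> hom (slice C c) g g' \<longleftrightarrow>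
     (\<exists>h. x = (g, h, g') \<and> g \<in> Arr C \<and> g' \<in> Arr C \<and> Cod C g = c \<and> Cod C g' = c \<and>
        h \<in> hom C (Dom C g) (Dom C g') \<and> g' \<cdot> h = g)"
  unfolding hom_def[of "slice C c"] unfolding slice_def by auto

text \<open>The forgetful functor from a slice preserves and reflects isomorphisms. Hence
  compactness, which is phrased in the slice, can be tested on the underlying morphisms.\<close>

lemma is_iso_slice_iff:
  assumes x: "(g, h, g') \<in> hom (slice C c) g g'"
  shows "is_iso (slice C c) (g, h, g') \<longleftrightarrow> is_iso C h"
proof -
  have H: "g \<in> hom C (Dom C g) c" "g' \<in> hom C (Dom C g') c"
    "h \<in> hom C (Dom C g) (Dom C g')" "g' \<cdot> h = g"
    using x unfolding in_hom_slice_iff by (auto simp: hom_def)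
  have S: "Dom (slice C c) (g, h, g') = g" "Cod (slice C c) (g, h, g') = g'"
    "\<And>k k' l l'. Comp (slice C c) (k, l, k') (g, h, l') = (g, l \<cdot> h, k')"
    "\<And>k k' l l'. Comp (slice C c) (k, h, k') (l, l', g) = (l, h \<cdot> l', k')"
    "\<And>k. Ident (slice C c) k = (k, Ident C (Dom C k), k)"
    by (simp_all add: slice_def)
  have D: "Dom C h = Dom C g" "Cod C h = Dom C g'" "h \<in> Arr C" using H(3) by (auto simp: hom_def)
  show ?thesis
  proof
    assume "is_iso (slice C c) (g, h, g')"
    then obtain m where m: "m \<in> hom (slice C c) g' g"
      "Comp (slice C c) m (g, h, g') = (g, Ident C (Dom C g), g)"
      "Comp (slice C c) (g, h, g') m = (g', Ident C (Dom C g'), g')"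
      unfolding is_iso_def S by blast
    then obtain l where "m = (g', l, g)" "l \<in> hom C (Dom C g') (Dom C g)"
      unfolding in_hom_slice_iff by blast
    with m(2,3) show "is_iso C h"
      unfolding is_iso_def D using D(3) by (auto simp: S)
  next
    assume "is_iso C h"
    then obtain l where l: "l \<in> hom C (Dom C g') (Dom C g)" "l \<cdot> h = Ident C (Dom C g)"
      "h \<cdot> l = Ident C (Dom C g')"
      unfolding is_iso_def D by blast
    \<comment> \<open>The inverse \<open>l\<close> of \<open>h\<close> is automatically a morphism
      over \<open>c\<close>.\<close>
    have "g \<cdot> l = g'"
      using comp_assoc[OF l(1) H(3,2)] comp_ident_right[OF H(2)] H(4) l(3) by simp
    then have "(g', l, g) \<in> hom (slice C c) g' g"
      using l(1) x unfolding in_hom_slice_iff by auto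
    moreover have "(g, h, g') \<in> Arr (slice C c)"
      using x by (simp add: hom_def)
    ultimately show "is_iso (slice C c) (g, h, g')"
      unfolding is_iso_def S using l by (intro conjI bexI[of _ "(g', l, g)"]) (auto simp: slice_def)
  qed
qed

lemma is_isoE:
  assumes "is_iso C f" "f \<in> hom C a b"
  obtains g where "g \<in> hom C b a" "g \<cdot> f = Ident C a" "f \<cdot> g = Ident C b"
  using assms unfolding is_iso_def by (auto simp: hom_def)

text \<open>The square exhibits the second factor as the kernel of the first projection
  \<open>p\<close>, with \<open>s\<close> the inclusion that has components zero and identity. Since
  \<open>q\<close> is a retraction of \<open>s\<close>, lifts are unique, and the lift of
  \<open>u\<close> can only be \<open>q \<cdot> u\<close>.\<close>

lemma product_projection_pullback:
  assumes "pointed C" "is_product C p q"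
  obtains z s n where "is_pullback C s n p z" "s \<in> hom C (Cod C q) (Dom C p)"
proof -
  obtain o0 where o0: "o0 \<in> Obj C"
    "\<forall>x \<in> Obj C. (\<exists>!f. f \<in> hom C o0 x) \<and> (\<exists>!f. f \<in> hom C x o0)"
    using assms(1) unfolding pointed_def by (elim bexE)
  define a x y where axy: "a = Dom C p" "x = Cod C p" "y = Cod C q"
  have p: "p \<in> hom C a x" and q: "q \<in> hom C a y"
    using assms(2) unfolding is_product_def hom_def axy by auto
  have P: "\<exists>!h. h \<in> hom C w a \<and> p \<cdot> h = u \<and> q \<cdot> h = v"
    if "u \<in> hom C w x" "v \<in> hom C w y" for w u v
    using assms(2) that unfolding is_product_def axy by blast
  have xy: "x \<in> Obj C" "y \<in> Obj C"
    using p q cod_in by (auto simp: hom_def)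
  obtain z n where z: "z \<in> hom C o0 x" and n: "n \<in> hom C y o0"
    using ex1_implies_ex[OF conjunct1[OF o0(2)[rule_format, OF xy(1)]]]
      ex1_implies_ex[OF conjunct2[OF o0(2)[rule_format, OF xy(2)]]] by (elim exE)
  obtain s where s: "s \<in> hom C y a" "p \<cdot> s = z \<cdot> n" "q \<cdot> s = Ident C y"
    using ex1_implies_ex[OF P[OF comp_in[OF n z] ident_in[OF xy(2)]]] by (elim exE conjE)
  have "is_pullback C s n p z"
  proof (rule is_pullbackI[OF s(1) n p z s(2)])
    fix w u v
    assume u: "u \<in> hom C w a" "v \<in> hom C w o0" "p \<cdot> u = z \<cdot> v"
    have w: "w \<in> Obj C" using u(1) dom_in by (auto simp: hom_def)
    have qu: "q \<cdot> u \<in> hom C w y" using comp_in[OF u(1) q] .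
    \<comment> \<open>Both sides are morphisms into the terminal object \<open>o0\<close>.\<close>
    have nv: "n \<cdot> (q \<cdot> u) = v"
      using conjunct2[OF o0(2)[rule_format, OF w]] comp_in[OF qu n] u(2) by (elim ex1E) metis
    have squ: "s \<cdot> (q \<cdot> u) \<in> hom C w a" using comp_in[OF qu s(1)] .
    have "p \<cdot> (s \<cdot> (q \<cdot> u)) = z \<cdot> (n \<cdot> (q \<cdot> u))"
      using comp_assoc[OF qu s(1) p] comp_assoc[OF qu n z] s(2) by simp
    moreover have "q \<cdot> (s \<cdot> (q \<cdot> u)) = q \<cdot> u"
      using comp_assoc[OF qu s(1) q] comp_ident_left[OF qu] s(3) by simp
    \<comment> \<open>Both sides have the same components under \<open>p\<close> and
      \<open>q\<close>; for \<open>p\<close> this is the assumed equation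
      \<open>p \<cdot> u = z \<cdot> v\<close>.\<close>
    ultimately have "s \<cdot> (q \<cdot> u) = u"
      using P[OF comp_in[OF u(1) p] qu] squ u(1,3) nv by (elim ex1E) metis
    with nv qu show "\<exists>h \<in> hom C w y. s \<cdot> h = u \<and> n \<cdot> h = v" by blast
  next
    fix w h h'
    assume h: "h \<in> hom C w y" "h' \<in> hom C w y" "s \<cdot> h = s \<cdot> h'"
    show "h = h'"
      using comp_assoc[OF h(1) s(1) q] comp_assoc[OF h(2) s(1) q] comp_ident_left[OF h(1)]
        comp_ident_left[OF h(2)] h(3) s(3) by simp
  qed
  with s(1) that show thesis unfolding axy by blast
qed

end

section \<open>Coverings, their arrows and their pullbacks\<close>

lemma variance_src_tgt:
  assumes "category I" "variance I" "k \<in> Arr I"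
  shows "src I k \<in> Obj I" "tgt I k \<in> Obj I"
proof -
  \<comment> \<open>Unique factorization makes the definite descriptions behind
    \<open>lo_contr\<close> and \<open>up_cov\<close> denote actual factorizations.\<close>
  have "(THE p. p \<in> factorizations I (Contr I) (Cov I) k) \<in> factorizations I (Contr I) (Cov I) k"
    "(THE p. p \<in> factorizations I (Cov I) (Contr I) k) \<in> factorizations I (Cov I) (Contr I) k"
    using assms(2,3) unfolding variance_def by (metis (no_types, lifting) theI')+
  then have "lo_contr I k \<in> Arr I" "up_cov I k \<in> Arr I"
    using assms(2) unfolding lo_contr_def up_cov_def factorizations_def variance_def
      wide_subcategory_def by auto
  then show "src I k \<in> Obj I" "tgt I k \<in> Obj I"
    using category.cod_in[OF assms(1)] by (auto simp: src_def tgt_def)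
qed

text \<open>Collects what quotients and weak extensions share. The conditions on \<open>E\<close>
  are stated result by result, because weak extensions are later applied to product projections,
  which are known to be image compatible but not to lie in \<open>E\<close>.\<close>

locale covered_category = category C
  for C :: "('o, 'm) cat" (structure) +
  fixes pb :: "'m \<Rightarrow> 'm \<Rightarrow> 'm \<times> 'm"
    and \<tau> :: "'o \<Rightarrow> ('i, 'j, 'm) covering set"
    and M :: "'m set"
  assumes pullback_choice: "pullback_choice C pb"
    and coverage: "coverage C pb \<tau>"
    and left_cancelable: "left_cancelable C M"
    and subordinated: "subordinated C \<tau> M"
begin

lemma coveringD:
  assumes "(I, F) \<in> \<tau> c" "c \<in> Obj C"
  shows "category I" "variance I" "diagram_type I" "variance_functor I (slice C c) F"
    "functor_subordinated I M F"
  using assms coverage subordinated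
  unfolding coverage_def global_selection_def subordinated_def diagram_type_def by blast+

lemma covering_arrow:
  assumes F: "(I, F) \<in> \<tau> c" "c \<in> Obj C" and k: "k \<in> Arr I"
  obtains g h g' where
    "farr F k = (g, h, g')" "fobj F (src I k) = g" "fobj F (tgt I k) = g'"
    "g \<in> hom C (Dom C g) c" "g' \<in> hom C (Dom C g') c"
    "h \<in> hom C (Dom C g) (Dom C g')" "g' \<cdot> h = g" "h \<in> M"
    "is_iso (slice C c) (farr F k) \<longleftrightarrow> is_iso C h"
proof -
  note D = coveringD[OF F]
  have "farr F k \<in> hom (slice C c) (fobj F (src I k)) (fobj F (tgt I k))"
    using D(4) k unfolding variance_functor_def by blast
  then obtain h where h: "farr F k = (fobj F (src I k), h, fobj F (tgt I k))"
    "(fobj F (src I k), h, fobj F (tgt I k)) \<in> hom (slice C c) (fobj F (src I k)) (fobj F (tgt I k))"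
    unfolding in_hom_slice_iff by auto
  have H: "fobj F (src I k) \<in> hom C (Dom C (fobj F (src I k))) c"
    "fobj F (tgt I k) \<in> hom C (Dom C (fobj F (tgt I k))) c"
    "h \<in> hom C (Dom C (fobj F (src I k))) (Dom C (fobj F (tgt I k)))"
    "fobj F (tgt I k) \<cdot> h = fobj F (src I k)"
    using h(2) unfolding in_hom_slice_iff by (auto simp: hom_def)
  have "fobj F (src I k) \<in> M" "fobj F (tgt I k) \<in> M"
    using D(5) variance_src_tgt[OF D(1,2) k] unfolding functor_subordinated_def by auto
  \<comment> \<open>Left cancelability applies to \<open>g' \<cdot> h = g\<close>, since
    \<open>\<tau>\<close> is subordinated to \<open>M\<close>.\<close>
  then have "h \<in> M"
    using left_cancelable H unfolding left_cancelable_def hom_def by auto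
  with that[OF h(1) refl refl H] is_iso_slice_iff[OF h(2)] show thesis by (simp add: h(1))
qed

lemma chosen_pullback:
  assumes "f \<in> hom C x y" "g \<in> hom C z y"
  shows "is_pullback C (fst (pb f g)) (snd (pb f g)) f g"
  using pullback_choice assms unfolding pullback_choice_def by (auto simp: hom_def)

text \<open>Replaces the definite description in \<open>pull_functor\<close> by a map
  \<open>k\<close> with its two defining equations. It is well defined because \<open>p\<close> and
  \<open>h \<cdot> q\<close> form a cone over \<open>f\<close> and \<open>g'\<close>.\<close>

lemma pull_functor_arrow:
  assumes f: "f \<in> hom C x y" and g: "g \<in> hom C a y" "g' \<in> hom C a' y"
    and h: "h \<in> hom C a a'" "g' \<cdot> h = g"
  obtains p q p' q' k b b' where
    "is_pullback C p q f g" "is_pullback C p' q' f g'"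
    "p \<in> hom C b x" "q \<in> hom C b a" "p' \<in> hom C b' x" "q' \<in> hom C b' a'"
    "k \<in> hom C b b'" "p' \<cdot> k = p" "q' \<cdot> k = h \<cdot> q"
    "farr (pull_functor C pb f) (g, h, g') = (p, k, p')"
proof -
  define p q p' q' where pq: "p = fst (pb f g)" "q = snd (pb f g)"
    "p' = fst (pb f g')" "q' = snd (pb f g')"
  have P: "is_pullback C p q f g" and P': "is_pullback C p' q' f g'"
    using chosen_pullback[OF f] g unfolding pq by auto
  obtain b where b: "p \<in> hom C b x" "q \<in> hom C b a" "Dom C p = b"
    using pullback_of_cospan[OF P f g(1)] .
  obtain b' where b': "p' \<in> hom C b' x" "q' \<in> hom C b' a'" "Dom C p' = b'"
    using pullback_of_cospan[OF P' f g(2)] .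
  have "f \<cdot> p = g' \<cdot> (h \<cdot> q)"
    using pullback_commutes[OF P] comp_assoc[OF b(2) h(1) g(2)] h(2) by simp
  then have "\<exists>k \<in> hom C b b'. p' \<cdot> k = p \<and> q' \<cdot> k = h \<cdot> q"
    by (rule pullback_lift[OF P' b'(1) f g(2) b(1) comp_in[OF b(2) h(1)]])
  then have "\<exists>!k. k \<in> hom C b b' \<and> p' \<cdot> k = p \<and> q' \<cdot> k = h \<cdot> q"
    using pullback_joint_mono[OF P' b'(1)] by metis
  from theI'[OF this] show thesis
    by (intro that[OF P P' b(1,2) b'(1,2), where k =
          "THE k. k \<in> hom C b b' \<and> p' \<cdot> k = p \<and> q' \<cdot> k = h \<cdot> q"])
       (auto simp: pull_functor_def pq[symmetric] b(3) b'(3))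
qed

lemma pulled_back_covering:
  assumes "f \<in> hom C x y" "(I, F) \<in> \<tau> y"
  shows "(I, funct_comp I (pull_functor C pb f) F) \<in> \<tau> x"
  using coverage assms unfolding coverage_def hom_def by blast

text \<open>Prepares the transfer of invertibility from the pulled back covering to
  \<open>F\<close>: the square \<open>q' \<cdot> l = h \<cdot> q\<close> links \<open>h\<close>,
  which underlies \<open>F(k)\<close>, to its invertible pullback \<open>l\<close>.\<close>

lemma pulled_back_arrow:
  assumes f: "f \<in> hom C x y" and F: "(I, F) \<in> \<tau> y" and k: "k \<in> Arr I"
    and iso: "is_iso (slice C x) (farr (funct_comp I (pull_functor C pb f) F) k)"
  obtains g h g' p q p' q' l b b' where
    "farr F k = (g, h, g')" "fobj F (src I k) = g" "fobj F (tgt I k) = g'"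
    "g \<in> hom C (Dom C g) y" "g' \<in> hom C (Dom C g') y"
    "h \<in> hom C (Dom C g) (Dom C g')" "g' \<cdot> h = g" "h \<in> M"
    "is_iso (slice C y) (farr F k) \<longleftrightarrow> is_iso C h"
    "is_pullback C p q f g" "is_pullback C p' q' f g'"
    "p \<in> hom C b x" "q \<in> hom C b (Dom C g)" "p' \<in> hom C b' x" "q' \<in> hom C b' (Dom C g')"
    "l \<in> hom C b b'" "p' \<cdot> l = p" "q' \<cdot> l = h \<cdot> q" "is_iso C l"
proof -
  have o: "x \<in> Obj C" "y \<in> Obj C"
    using f dom_in cod_in by (auto simp: hom_def)
  obtain g h g' where A:
    "farr F k = (g, h, g')" "fobj F (src I k) = g" "fobj F (tgt I k) = g'"
    "g \<in> hom C (Dom C g) y" "g' \<in> hom C (Dom C g') y"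
    "h \<in> hom C (Dom C g) (Dom C g')" "g' \<cdot> h = g" "h \<in> M"
    "is_iso (slice C y) (farr F k) \<longleftrightarrow> is_iso C h"
    using covering_arrow[OF F o(2) k] .
  obtain p q p' q' l b b' where B:
    "is_pullback C p q f g" "is_pullback C p' q' f g'"
    "p \<in> hom C b x" "q \<in> hom C b (Dom C g)" "p' \<in> hom C b' x" "q' \<in> hom C b' (Dom C g')"
    "l \<in> hom C b b'" "p' \<cdot> l = p" "q' \<cdot> l = h \<cdot> q"
    "farr (pull_functor C pb f) (g, h, g') = (p, l, p')"
    using pull_functor_arrow[OF f A(4,5,6,7)] .
  have "farr (funct_comp I (pull_functor C pb f) F) k = (p, l, p')"
    using k A(1) B(10) by (simp add: funct_comp_def)
  then have "is_iso C l"
    using covering_arrow[OF pulled_back_covering[OF f F] o(1) k] iso by (metis prod.inject)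
  from that[OF A B(1-9) this] show thesis .
qed

lemma compact_objectsD:
  assumes "c \<in> compact_objects C \<tau>" "(I, F) \<in> \<tau> c"
  obtains i\<^sub>0 where "i\<^sub>0 \<in> Designated I"
    "\<And>i j u k. \<lbrakk>u \<in> hom I i\<^sub>0 i; k \<in> hom I i j\<rbrakk> \<Longrightarrow> is_iso (slice C c) (farr F k)"
  using assms unfolding compact_objects_def by blast

lemma compact_objectsI:
  assumes "c \<in> Obj C"
    and "\<And>I F. (I, F) \<in> \<tau> c \<Longrightarrow> \<exists>i\<^sub>0 \<in> Designated I.
      \<forall>i j. \<forall>u \<in> hom I i\<^sub>0 i. \<forall>k \<in> hom I i j. is_iso (slice C c) (farr F k)"
  shows "c \<in> compact_objects C \<tau>"
  using assms unfolding compact_objects_def by auto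

section \<open>Closure under quotients\<close>

lemma compact_quotient:
  assumes f: "f \<in> hom C x y" and x: "x \<in> compact_objects C \<tau>"
    and E: "stably_extremal_epi C M f \<or>
      f \<in> E \<and> right_cancelable C E \<and> system C E \<and> stable C E \<and> E \<inter> M = {f. is_iso C f}"
  shows "y \<in> compact_objects C \<tau>"
proof (rule compact_objectsI)
  show "y \<in> Obj C" using f cod_in by (auto simp: hom_def)
  fix I F
  assume F: "(I, F) \<in> \<tau> y"
  \<comment> \<open>The index that compactness of \<open>x\<close> gives for the pullback of
    \<open>F\<close> along \<open>f\<close> also serves for \<open>F\<close>.\<close>
  obtain i\<^sub>0 where i\<^sub>0: "i\<^sub>0 \<in> Designated I" "\<And>i j u k. \<lbrakk>u \<in> hom I i\<^sub>0 i; k \<in> hom I i j\<rbrakk> \<Longrightarrow>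
      is_iso (slice C x) (farr (funct_comp I (pull_functor C pb f) F) k)"
    using compact_objectsD[OF x pulled_back_covering[OF f F]] by metis
  have "is_iso (slice C y) (farr F k)" if "u \<in> hom I i\<^sub>0 i" "k \<in> hom I i j" for u i j k
  proof -
    have "k \<in> Arr I" using that(2) by (simp add: hom_def)
    from pulled_back_arrow[OF f F this i\<^sub>0(2)[OF that]]
    obtain g h g' p q p' q' l b b' where A:
      "farr F k = (g, h, g')" "fobj F (src I k) = g" "fobj F (tgt I k) = g'"
      "g \<in> hom C (Dom C g) y" "g' \<in> hom C (Dom C g') y"
      "h \<in> hom C (Dom C g) (Dom C g')" "g' \<cdot> h = g" "h \<in> M"
      "is_iso (slice C y) (farr F k) \<longleftrightarrow> is_iso C h"
      "is_pullback C p q f g" "is_pullback C p' q' f g'"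
      "p \<in> hom C b x" "q \<in> hom C b (Dom C g)" "p' \<in> hom C b' x" "q' \<in> hom C b' (Dom C g')"
      "l \<in> hom C b b'" "p' \<cdot> l = p" "q' \<cdot> l = h \<cdot> q" "is_iso C l" .
    have "is_iso C h" using E
    proof
      assume "stably_extremal_epi C M f"
      then have "extremal_epi C M q'"
        using pullback_sym[OF A(11)] unfolding stably_extremal_epi_def by blast
      moreover obtain l' where l': "l' \<in> hom C b' b" "l \<cdot> l' = Ident C b'"
        using is_isoE[OF A(19,16)] .
      \<comment> \<open>The pullback \<open>q'\<close> of \<open>f\<close> factors through
        \<open>h\<close>, which lies in \<open>M\<close>, so extremality makes \<open>h\<close>
        invertible.\<close>
      moreover have "q' = h \<cdot> (q \<cdot> l')"
        using comp_assoc[OF l'(1) A(16,15)] comp_assoc[OF l'(1) A(13,6)] comp_ident_right[OF A(15)]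
          A(18) l'(2) by simp
      moreover have "q \<cdot> l' \<in> Arr C" "Cod C (q \<cdot> l') = Dom C h"
        using comp_in[OF l'(1) A(13)] A(6) by (auto simp: hom_def)
      ultimately show ?thesis
        using A(8) unfolding extremal_epi_def by blast
    next
      assume S: "f \<in> E \<and> right_cancelable C E \<and> system C E \<and> stable C E \<and> E \<inter> M = {f. is_iso C f}"
      then have "q \<in> E" "q' \<in> E"
        using pullback_sym[OF A(10)] pullback_sym[OF A(11)] unfolding stable_def by blast+
      moreover have "l \<in> E" using S A(19) by blast
      \<comment> \<open>This composite equals \<open>q' \<cdot> l\<close>. Cancelling
        \<open>q\<close> on the right then puts \<open>h\<close> in both \<open>E\<close> and
        \<open>M\<close>.\<close>
      ultimately have "h \<cdot> q \<in> E"
        using S A(15,16,18) unfolding system_def hom_def by force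
      then have "h \<in> E"
        using S \<open>q \<in> E\<close> A(6,13) unfolding right_cancelable_def hom_def by auto
      then show ?thesis using S A(8) by blast
    qed
    then show ?thesis using A(9) by blast
  qed
  with i\<^sub>0(1) show "\<exists>i\<^sub>0 \<in> Designated I.
      \<forall>i j. \<forall>u \<in> hom I i\<^sub>0 i. \<forall>k \<in> hom I i j. is_iso (slice C y) (farr F k)" by blast
qed

section \<open>Closure under weak extensions\<close>

lemma natural_component:
  assumes f: "f \<in> hom C b c" and F: "(I, F) \<in> \<tau> b"
    and \<eta>: "natural_transformation I (slice C c) (funct_comp I (post_functor C f) F) G \<eta>"
    and i: "i \<in> Obj I"
  obtains e where "\<eta> i = (f \<cdot> fobj F i, e, fobj G i)" "underlying (\<eta> i) = e"
    "fobj G i \<in> hom C (Dom C (fobj G i)) c" "fobj F i \<in> hom C (Dom C (fobj F i)) b"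
    "e \<in> hom C (Dom C (fobj F i)) (Dom C (fobj G i))" "fobj G i \<cdot> e = f \<cdot> fobj F i"
proof -
  have "b \<in> Obj C" using f dom_in by (auto simp: hom_def)
  then have "fobj F i \<in> Obj (slice C b)"
    using coveringD(4)[OF F] i unfolding variance_functor_def by blast
  then have Fi: "fobj F i \<in> hom C (Dom C (fobj F i)) b"
    by (simp add: slice_def hom_def)
  have "\<eta> i \<in> hom (slice C c) (f \<cdot> fobj F i) (fobj G i)"
    using \<eta> i unfolding natural_transformation_def by (auto simp: funct_comp_def post_functor_def)
  then obtain e where "\<eta> i = (f \<cdot> fobj F i, e, fobj G i)"
    "fobj G i \<in> Arr C" "Cod C (fobj G i) = c"
    "e \<in> hom C (Dom C (f \<cdot> fobj F i)) (Dom C (fobj G i))" "fobj G i \<cdot> e = f \<cdot> fobj F i"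
    unfolding in_hom_slice_iff by blast
  moreover have "Dom C (f \<cdot> fobj F i) = Dom C (fobj F i)"
    using comp_in[OF Fi f] by (simp add: hom_def)
  ultimately show thesis
    using Fi by (intro that) (auto simp: underlying_def hom_def)
qed

lemma compact_weak_extension:
  assumes proto: "protomodular C E M" and comp: "image_compatible C \<tau> E M f"
    and sq: "is_pullback C \<phi>' f' f \<phi>" and f: "f \<in> hom C b c" and \<phi>': "\<phi>' \<in> hom C a b"
    and a: "a \<in> compact_objects C \<tau>" and c: "c \<in> compact_objects C \<tau>"
  shows "b \<in> compact_objects C \<tau>"
proof (rule compact_objectsI)
  show b: "b \<in> Obj C" using f dom_in by (auto simp: hom_def)
  have c': "c \<in> Obj C" using f cod_in by (auto simp: hom_def)
  obtain d e where d: "f' \<in> hom C a d" "f \<in> hom C b e" "\<phi> \<in> hom C d e"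
    using pullback_leg[OF sq \<phi>'] .
  have f': "f' \<in> hom C a d" and \<phi>: "\<phi> \<in> hom C d c"
    using d f by (auto simp: hom_def)
  fix I F
  assume F: "(I, F) \<in> \<tau> b"
  note I = coveringD[OF F b]
  obtain G \<eta> where G: "(I, G) \<in> \<tau> c"
    and \<eta>: "natural_transformation I (slice C c) (funct_comp I (post_functor C f) F) G \<eta>"
    and \<eta>E: "\<And>i. i \<in> Obj I \<Longrightarrow> underlying (\<eta> i) \<in> E"
    using comp f F unfolding image_compatible_def hom_def by blast
  obtain i\<^sub>1 where i\<^sub>1: "i\<^sub>1 \<in> Designated I" "\<And>i j u k. \<lbrakk>u \<in> hom I i\<^sub>1 i; k \<in> hom I i j\<rbrakk> \<Longrightarrow>
      is_iso (slice C a) (farr (funct_comp I (pull_functor C pb \<phi>') F) k)"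
    using compact_objectsD[OF a pulled_back_covering[OF \<phi>' F]] by metis
  obtain i\<^sub>2 where i\<^sub>2: "i\<^sub>2 \<in> Designated I" "\<And>i j u k. \<lbrakk>u \<in> hom I i\<^sub>2 i; k \<in> hom I i j\<rbrakk> \<Longrightarrow>
      is_iso (slice C c) (farr G k)"
    using compact_objectsD[OF c G] by metis
  \<comment> \<open>Directedness of the designated objects: any arrow out of \<open>z\<close>
    extends to one out of \<open>i\<^sub>1\<close> and one out of \<open>i\<^sub>2\<close>, so both
    compactness properties hold beyond \<open>z\<close>.\<close>
  obtain z u\<^sub>1 u\<^sub>2 where z: "z \<in> Designated I" "u\<^sub>1 \<in> hom I i\<^sub>1 z" "u\<^sub>2 \<in> hom I i\<^sub>2 z"
    using I(3) i\<^sub>1(1) i\<^sub>2(1) unfolding diagram_type_def by blast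
  have "is_iso (slice C b) (farr F k)" if uk: "u \<in> hom I z i" "k \<in> hom I i j" for u i j k
  proof -
    have k: "k \<in> Arr I" using uk(2) by (simp add: hom_def)
    have isoF: "is_iso (slice C a) (farr (funct_comp I (pull_functor C pb \<phi>') F) k)"
      using i\<^sub>1(2) category.comp_in[OF I(1) z(2) uk(1)] uk(2) by blast
    have isoG: "is_iso (slice C c) (farr G k)"
      using i\<^sub>2(2) category.comp_in[OF I(1) z(3) uk(1)] uk(2) by blast
    \<comment> \<open>The letters follow the protomodularity condition: \<open>\<beta>\<close>
      underlies \<open>F(k)\<close>, \<open>\<alpha>\<close> is its pullback along
      \<open>\<phi>'\<close>, and below \<open>\<gamma>\<close> underlies \<open>G(k)\<close> while
      \<open>e'\<close> and \<open>e\<close> are the components of \<open>\<eta>\<close>.\<close>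
    obtain s \<beta> t p m' p' m \<alpha> x y where A:
      "farr F k = (s, \<beta>, t)" "fobj F (src I k) = s" "fobj F (tgt I k) = t"
      "s \<in> hom C (Dom C s) b" "t \<in> hom C (Dom C t) b"
      "\<beta> \<in> hom C (Dom C s) (Dom C t)" "t \<cdot> \<beta> = s" "\<beta> \<in> M"
      "is_iso (slice C b) (farr F k) \<longleftrightarrow> is_iso C \<beta>"
      "is_pullback C p m' \<phi>' s" "is_pullback C p' m \<phi>' t"
      "p \<in> hom C x a" "m' \<in> hom C x (Dom C s)" "p' \<in> hom C y a" "m \<in> hom C y (Dom C t)"
      "\<alpha> \<in> hom C x y" "p' \<cdot> \<alpha> = p" "m \<cdot> \<alpha> = \<beta> \<cdot> m'" "is_iso C \<alpha>"
      using pulled_back_arrow[OF \<phi>' F k isoF] .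
    obtain g \<gamma> g' where B:
      "farr G k = (g, \<gamma>, g')" "fobj G (src I k) = g" "fobj G (tgt I k) = g'"
      "g \<in> hom C (Dom C g) c" "g' \<in> hom C (Dom C g') c"
      "\<gamma> \<in> hom C (Dom C g) (Dom C g')" "g' \<cdot> \<gamma> = g" "\<gamma> \<in> M"
      "is_iso (slice C c) (farr G k) \<longleftrightarrow> is_iso C \<gamma>"
      using covering_arrow[OF G c' k] .
    note st = variance_src_tgt[OF I(1,2) k]
    obtain e' where "\<eta> (src I k) = (f \<cdot> fobj F (src I k), e', fobj G (src I k))"
      "underlying (\<eta> (src I k)) = e'"
      "e' \<in> hom C (Dom C (fobj F (src I k))) (Dom C (fobj G (src I k)))"
      by (rule natural_component[OF f F \<eta> st(1)])
    then have e': "\<eta> (src I k) = (f \<cdot> s, e', g)" "e' \<in> E" "e' \<in> hom C (Dom C s) (Dom C g)"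
      using \<eta>E[OF st(1)] A(2) B(2) by simp_all
    obtain e where "\<eta> (tgt I k) = (f \<cdot> fobj F (tgt I k), e, fobj G (tgt I k))"
      "underlying (\<eta> (tgt I k)) = e"
      "e \<in> hom C (Dom C (fobj F (tgt I k))) (Dom C (fobj G (tgt I k)))"
      "fobj G (tgt I k) \<cdot> e = f \<cdot> fobj F (tgt I k)"
      by (rule natural_component[OF f F \<eta> st(2)])
    then have e: "\<eta> (tgt I k) = (f \<cdot> t, e, g')" "e \<in> E" "e \<in> hom C (Dom C t) (Dom C g')"
      "g' \<cdot> e = f \<cdot> t"
      using \<eta>E[OF st(2)] A(3) B(3) by simp_all
    have "Comp (slice C c) (farr G k) (\<eta> (src I k)) =
        Comp (slice C c) (\<eta> (tgt I k)) (farr (funct_comp I (post_functor C f) F) k)"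
      using \<eta> k unfolding natural_transformation_def by blast
    then have nat: "e \<cdot> \<beta> = \<gamma> \<cdot> e'"
      using k by (simp add: A(1) B(1) e(1) e'(1) funct_comp_def post_functor_def slice_def)
    \<comment> \<open>Pasted with the pullback of \<open>t\<close> along \<open>\<phi>'\<close>,
      this square becomes the pullback of \<open>s = t \<cdot> \<beta>\<close> along
      \<open>\<phi>'\<close>, so it can be cancelled out.\<close>
    have left: "is_pullback C m' \<alpha> \<beta> m"
      by (rule pullback_cancel[OF pullback_sym[OF A(11)] _ A(13,6,16,15)])
         (use pullback_sym[OF A(10)] A(7,17,18) in auto)
    \<comment> \<open>Pasting onto the given square yields a pullback over
      \<open>f \<cdot> t\<close>, which equals \<open>g' \<cdot> e\<close> because the components of
      \<open>\<eta>\<close> are morphisms over \<open>c\<close>.\<close>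
    have outer: "is_pullback C m (f' \<cdot> p') (g' \<cdot> e) \<phi>"
      using pullback_paste[OF pullback_sym[OF A(11)] sq] e(4) by simp
    \<comment> \<open>Protomodularity needs \<open>m\<close> to be a pullback along \<open>e\<close>
      of some morphism. The choice is \<open>\<theta>\<close>, the pullback of \<open>\<phi>\<close>
      along \<open>g'\<close>: the outer pullback factors through its square by \<open>T\<close>,
      and cancellation applies.\<close>
    obtain \<theta> r where Q: "is_pullback C \<theta> r g' \<phi>"
      using chosen_pullback[OF B(5) \<phi>] by blast
    obtain w where \<theta>: "\<theta> \<in> hom C w (Dom C g')"
      using pullback_of_cospan[OF Q B(5) \<phi>] by metis
    have "g' \<cdot> (e \<cdot> m) = \<phi> \<cdot> (f' \<cdot> p')"
      using pullback_commutes[OF outer] comp_assoc[OF A(15) e(3) B(5)] by simp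
    then obtain T where T: "T \<in> hom C y w" "\<theta> \<cdot> T = e \<cdot> m" "r \<cdot> T = f' \<cdot> p'"
      using pullback_lift[OF Q \<theta> B(5) \<phi> comp_in[OF A(15) e(3)] comp_in[OF A(14) f']] by blast
    have "is_pullback C m T e \<theta>"
      by (rule pullback_cancel[OF Q _ A(15) e(3) T(1) \<theta>]) (use outer T in auto)
    then have "is_iso C \<beta>"
      using proto[unfolded protomodular_def, rule_format, of m' x "Dom C s" e' "Dom C g" m y
          "Dom C t" e "Dom C g'" \<alpha> \<beta> \<gamma>]
        A(6,8,13,15,16,19) B(6,9) e(2,3) e'(2,3) isoG left nat \<theta> by blast
    then show ?thesis using A(9) by blast
  qed
  with z(1) show "\<exists>i\<^sub>0 \<in> Designated I.
      \<forall>i j. \<forall>u \<in> hom I i\<^sub>0 i. \<forall>k \<in> hom I i j. is_iso (slice C b) (farr F k)" by blast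
qed

end

section \<open>Closure properties of the compact objects\<close>

theorem corollary2p16:
  fixes C :: "('o, 'm) cat"
    and pb :: "'m \<Rightarrow> 'm \<Rightarrow> 'm \<times> 'm"
    and \<tau> :: "'o \<Rightarrow> ('i, 'j, 'm) covering set"
    and E M :: "'m set"
  assumes "category C" and "pullback_choice C pb"
    and "coverage C pb \<tau>"
    and "E \<subseteq> Arr C" and "M \<subseteq> Arr C"
    and "well_behaved C \<tau> E M"
  shows "closed_under_quotients C E (compact_objects C \<tau>) \<and>
    closed_under_weak_extensions C E (compact_objects C \<tau>) \<and>
    (pointed C \<and> (\<forall>p q. is_product C p q \<longrightarrow> image_compatible C \<tau> E M p) \<longrightarrow>
      closed_under_binary_products C (compact_objects C \<tau>))"
proof -
  note W = assms(6)[unfolded well_behaved_def]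
  interpret covered_category C pb \<tau> M
    using assms W unfolding covered_category_def covered_category_axioms_def by blast
  let ?X = "compact_objects C \<tau>"
  have proto: "protomodular C E M" using W by blast
  have "closed_under_quotients C E ?X"
    unfolding closed_under_quotients_def
  proof (intro ballI impI)
    fix f
    assume f: "f \<in> E" "Dom C f \<in> ?X"
    then have "f \<in> hom C (Dom C f) (Cod C f)" using assms(4) by (auto simp: hom_def)
    moreover have "stably_extremal_epi C M f \<or>
      f \<in> E \<and> right_cancelable C E \<and> system C E \<and> stable C E \<and> E \<inter> M = {f. is_iso C f}"
      using W f(1) by blast
    ultimately show "Cod C f \<in> ?X" using compact_quotient f(2) by blast
  qed
  moreover have "closed_under_weak_extensions C E ?X"
    unfolding closed_under_weak_extensions_def using W compact_weak_extension[OF proto] by blast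
  moreover have "closed_under_binary_products C ?X"
    if "pointed C" "\<forall>p q. is_product C p q \<longrightarrow> image_compatible C \<tau> E M p"
    unfolding closed_under_binary_products_def
  proof (intro allI impI)
    fix p q
    assume pq: "is_product C p q \<and> Cod C p \<in> ?X \<and> Cod C q \<in> ?X"
    then have "p \<in> hom C (Dom C p) (Cod C p)" unfolding is_product_def hom_def by blast
    \<comment> \<open>The kernel square of \<open>p\<close> is a weak extension square with compact
      corners \<open>Cod C q\<close> and \<open>Cod C p\<close>.\<close>
    with pq that show "Dom C p \<in> ?X"
      using product_projection_pullback[of p q] compact_weak_extension[OF proto] by metis
  qed
  ultimately show ?thesis by blast
qed

end
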